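(* Let $x\in X\subset\{0,1\}^n$, suppose $Q=\sum_{i=1}^KL_iL_i^\top+\mathrm{diag}(\delta)+N$ with $\delta\geq 0$ (in fact $\delta_i>0$ for all $i$) and $N\succcurlyeq0$, and let $R=\sum_{i=1}^KL_iL_i^\top+N$. Let $t\in\mathbb{R}^n$ be the vector returned by procedure $\mathrm{CUT}_{\mathrm{persp+ro}}$ (described in the context) on input $x$. Then $t\in\partial\bar f_{\mathrm{persp+ro}}(x)$, and the inequality $$\tilde\eta\ge\langle t,\tilde x-x\rangle+\bar f_{\mathrm{persp+ro}}(x)$$ holds for every $(\tilde x,\tilde y,\tilde\eta)\in\mathcal Z$.
   Context: Problem data: $Q\in\mathbb{R}^{n\times n}$ symmetric positive definite, $g,h\in\mathbb{R}^n$, $A\in\mathbb{R}^{m_1\times n}$, $b\in\mathbb{R}^{m_1}$, $C,D\in\mathbb{R}^{m_2\times n}$, $X\subseteq\{0,1\}^n$, and $$\mathcal Z=\{(x,y,\eta)\in X\times\mathbb{R}^{n+1}:\eta\ge y^\top Qy+g^\top y+h^\top x,\ Ay\le b,\ Cy\le Dx,\ y_i(1-x_i)=0\ \forall i\}.$$ Standing assumption: $\mathcal Z\neq\emptyset$. $L_i\in\mathbb{R}^n$ is the $i$th column of $L\in\mathbb{R}^{n\times K}$, $1\le K\le n$; $N$ is symmetric positive semidefinite. Conventions: quotients $a^2/s$ are the closed perspective function: $a^2/s$ if $s>0$, $0$ if $a=s=0$, $+\infty$ otherwise. Let $F_1=\{y:Ay\le b\}$, $F_2=\{(x,y):Cy\le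 Dx\}$; $\mathcal I_{\mathcal C}$ is the ($0/{+\infty}$) indicator function of $\mathcal C$. Define on $\mathbb{R}^n\times\mathbb{R}^n$ $$f_{\mathrm{persp+ro}}(x,y)=\sum_{i=1}^K\max\Big\{(L_i^\top y)^2,\frac{(L_i^\top y)^2}{\sum_{1\le j\le n,\,L_{ji}\ne0}x_j}\Big\}+y^\top Ny+\sum_{i=1}^n\delta_i\frac{y_i^2}{x_i}+g^\top y+h^\top x+\mathcal I_{F_1}(y)+\mathcal I_{F_2}(x,y),$$ $\bar f_{\mathrm{persp+ro}}(x)=\inf_{y\in\mathbb{R}^n}f_{\mathrm{persp+ro}}(x,y)$. $\partial$ is the convex subdifferential. Notation: $H_i$ is the $i$th column of a matrix $H$; subscript $S$ on $A,C$ selects columns, on $R$ the principal submatrix, on vectors the subvector. Procedure $\mathrm{CUT}_{\mathrm{persp+ro}}$ at $x$. Let $S=\{i:x_i>0\}$, $S^C=[n]\setminus S$, $I^0=\{i\in\{1,\dots,K\}:\sum_{l:\,L_{li}\ne0}x_l=0\}$ (zero columns $L_i$ are ignored). (1) Let $y_i=0$ for $i\in S^C$ and let $(y_S,\lambda,\mu)$ be a primal-dual optimal (KKT) solution of $$\min_{\tilde y\in\mathbb{R}^{|S|}}\ \tilde y^\top\big(R_S+\mathrm{diag}(\{\delta_i/x_i\}_{i\in S})\big)\tilde y+g_S^\top\tilde y\quad\text{s.t. }A_S\tilde y\le b,\ C_S\tilde y\le Dx,$$ i.e. $y_S$ feasible, $\lambda,\mu\ge0$, $2(R_S+\mathrm{diag}(\{\delta_i/x_i\}_{i\in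 S}))y_S+g_S+A_S^\top\lambda+C_S^\top\mu=0$, $\lambda^\top(A_Sy_S-b)=0$, $\mu^\top(C_Sy_S-Dx)=0$. The QP is assumed feasible at $x$, so that the procedure returns a vector. (2) For $i\in S$ set $t_i=-\delta_iy_i^2/x_i^2-\mu^\top D_i+h_i$. (3) For $i\in I^0$ set $n_i=|\{j:L_{ji}\ne0\}|$. For $i\in S^C$ set $r_i=-2\sum_{j\in S}R_{ij}y_j-g_i-\lambda^\top A_i-\mu^\top C_i$. (4) Solve $\big(\mathrm{diag}(\{\delta_i\}_{i\in S^C})+\sum_{i\in I^0}\frac1{n_i}(L_i)_{S^C}(L_i)_{S^C}^\top\big)\beta=2r$ for $\beta\in\mathbb{R}^{|S^C|}$. (5) Set $\Psi_i=\frac12\beta_i$ for $i\in S^C$ and $\psi_i=\frac1{2n_i}\sum_{j\in S^C}L_{ji}\beta_j$ for $i\in I^0$. (6) For $i\in S^C$ set $t_i=-\frac{\delta_i}4\Psi_i^2-\frac14\sum_{j\in I^0,\,L_{ij}\ne0}\psi_j^2-\mu^\top D_i+h_i$. Return $t$. *)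

theory Defs
  imports "HOL-Analysis.Analysis"
begin

definition pos_def :: "real^'n^'n \<Rightarrow> bool" where
  "pos_def M \<longleftrightarrow> transpose M = M \<and> (\<forall>v. v \<noteq> 0 \<longrightarrow> v \<bullet> (M *v v) > 0)"

definition pos_semidef :: "real^'n^'n \<Rightarrow> bool" where
  "pos_semidef M \<longleftrightarrow> transpose M = M \<and> (\<forall>v. v \<bullet> (M *v v) \<ge> 0)"

definition diag_mat :: "real^'n \<Rightarrow> real^'n^'n" where
  "diag_mat d = (\<chi> i j. if i = j then d $ i else 0)"

definition outer :: "real^'n \<Rightarrow> real^'n^'n" where
  "outer v = (\<chi> i j. v $ i * v $ j)"

definition persp :: "real \<Rightarrow> real \<Rightarrow> ereal" where
  "persp a s = (if s > 0 then ereal (a\<^sup>2 / s) else if a = 0 \<and> s = 0 then 0 else \<infinity>)"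

definition ind :: "'a set \<Rightarrow> 'a \<Rightarrow> ereal" where
  "ind S z = (if z \<in> S then 0 else \<infinity>)"

text \<open>Convex subdifferential of an extended-real-valued function; it is empty wherever the
  function is not finite.\<close>

definition subdifferential :: "('a::real_inner \<Rightarrow> ereal) \<Rightarrow> 'a \<Rightarrow> 'a set" where
  "subdifferential f x = {t. \<bar>f x\<bar> \<noteq> \<infinity> \<and> (\<forall>z. f z \<ge> f x + ereal (t \<bullet> (z - x)))}"

text \<open>Vectors are compared componentwise, so \<open>A *v y \<le> b\<close> is a system of linear inequalities.\<close>

definition feasible_Z ::
  "(real^'n) set \<Rightarrow> real^'n^'n \<Rightarrow> real^'n \<Rightarrow> real^'n \<Rightarrow> real^'n^'p \<Rightarrow> real^'p \<Rightarrow>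
   real^'n^'q \<Rightarrow> real^'n^'q \<Rightarrow> ((real^'n) \<times> (real^'n) \<times> real) set" where
  "feasible_Z X Q g h A b C D = {(x, y, \<eta>). x \<in> X \<and>
     \<eta> \<ge> y \<bullet> (Q *v y) + g \<bullet> y + h \<bullet> x \<and>
     A *v y \<le> b \<and> C *v y \<le> D *v x \<and> (\<forall>i. y $ i * (1 - x $ i) = 0)}"

definition col_supp :: "real^'k^'n \<Rightarrow> 'k \<Rightarrow> 'n set" where
  "col_supp L k = {j. L $ j $ k \<noteq> 0}"

definition f_persp_ro ::
  "real^'k^'n \<Rightarrow> real^'n^'n \<Rightarrow> real^'n \<Rightarrow> real^'n \<Rightarrow> real^'n \<Rightarrow> real^'n^'p \<Rightarrow> real^'p \<Rightarrow>
   real^'n^'q \<Rightarrow> real^'n^'q \<Rightarrow> real^'n \<Rightarrow> real^'n \<Rightarrow> ereal" where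
  "f_persp_ro L N \<delta> g h A b C D x y =
     (\<Sum>k\<in>UNIV. max (ereal ((column k L \<bullet> y)\<^sup>2))
                    (persp (column k L \<bullet> y) (\<Sum>j\<in>col_supp L k. x $ j)))
     + ereal (y \<bullet> (N *v y))
     + (\<Sum>i\<in>UNIV. ereal (\<delta> $ i) * persp (y $ i) (x $ i))
     + ereal (g \<bullet> y) + ereal (h \<bullet> x)
     + ind {y. A *v y \<le> b} y
     + ind {(x, y). C *v y \<le> D *v x} (x, y)"

definition fbar_persp_ro ::
  "real^'k^'n \<Rightarrow> real^'n^'n \<Rightarrow> real^'n \<Rightarrow> real^'n \<Rightarrow> real^'n \<Rightarrow> real^'n^'p \<Rightarrow> real^'p \<Rightarrow>
   real^'n^'q \<Rightarrow> real^'n^'q \<Rightarrow> real^'n \<Rightarrow> ereal" where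
  "fbar_persp_ro L N \<delta> g h A b C D x = (INF y. f_persp_ro L N \<delta> g h A b C D x y)"

text \<open>The vector $M_S v_S$, where $M_S$ consists of the columns of $M$ indexed by $S$. For \<open>i \<in> S\<close>
  its \<open>i\<close>th component is also that of the principal submatrix of a square \<open>M\<close> applied to $v_S$.\<close>

definition mult_cols :: "'n set \<Rightarrow> real^'n^'m \<Rightarrow> real^'n \<Rightarrow> real^'m" where
  "mult_cols S M v = (\<chi> k. \<Sum>j\<in>S. M $ k $ j * v $ j)"

text \<open>KKT conditions of the quadratic program over $\mathbb{R}^{|S|}$ that minimises
  $y_S^\top (R_S + \mathrm{diag}(\delta_i/x_i)_{i\in S}) y_S + g_S^\top y_S$ subject to
  $A_S y_S \le b$, $C_S y_S \le D x$. A vector $y_S$ is represented by its extension by zero.\<close>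

definition is_kkt ::
  "real^'n^'n \<Rightarrow> real^'n \<Rightarrow> real^'n \<Rightarrow> real^'n^'p \<Rightarrow> real^'p \<Rightarrow> real^'n^'q \<Rightarrow> real^'n^'q \<Rightarrow>
   'n set \<Rightarrow> real^'n \<Rightarrow> real^'n \<Rightarrow> real^'p \<Rightarrow> real^'q \<Rightarrow> bool" where
  "is_kkt R \<delta> g A b C D S x y lam mu \<longleftrightarrow>
     (\<forall>i\<in>-S. y $ i = 0) \<and>
     mult_cols S A y \<le> b \<and> mult_cols S C y \<le> D *v x \<and>
     0 \<le> lam \<and> 0 \<le> mu \<and>
     (\<forall>i\<in>S. 2 * (mult_cols S R y $ i + \<delta> $ i / x $ i * y $ i) + g $ i
              + column i A \<bullet> lam + column i C \<bullet> mu = 0) \<and>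
     lam \<bullet> (mult_cols S A y - b) = 0 \<and> mu \<bullet> (mult_cols S C y - D *v x) = 0"

text \<open>\<open>cut_persp_ro \<dots> x t\<close>: the procedure, run at \<open>x\<close>, can return \<open>t\<close> (the dual solution need not be
  unique). Of \<open>\<beta>\<close>, \<open>r\<close> and \<open>\<Psi>\<close> only the components in \<open>-S\<close> are used, of \<open>\<psi>\<close> only those in \<open>I0\<close>.\<close>

definition cut_persp_ro ::
  "real^'k^'n \<Rightarrow> real^'n^'n \<Rightarrow> real^'n \<Rightarrow> real^'n \<Rightarrow> real^'n \<Rightarrow> real^'n^'p \<Rightarrow> real^'p \<Rightarrow>
   real^'n^'q \<Rightarrow> real^'n^'q \<Rightarrow> real^'n \<Rightarrow> real^'n \<Rightarrow> bool" where
  "cut_persp_ro L R \<delta> g h A b C D x t \<longleftrightarrow>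
     (let S = {i. x $ i > 0};
          I0 = {k. column k L \<noteq> 0 \<and> (\<Sum>l\<in>col_supp L k. x $ l) = 0};
          n = (\<lambda>k. real (card (col_supp L k)))
      in \<exists>y lam mu r \<beta> \<Psi> \<psi>.
           is_kkt R \<delta> g A b C D S x y lam mu \<and>
           (\<forall>i\<in>S. t $ i = - \<delta> $ i * (y $ i)\<^sup>2 / (x $ i)\<^sup>2 - mu \<bullet> column i D + h $ i) \<and>
           (\<forall>i\<in>-S. r i = - 2 * (\<Sum>j\<in>S. R $ i $ j * y $ j) - g $ i
                            - lam \<bullet> column i A - mu \<bullet> column i C) \<and>
           (\<forall>i\<in>-S. \<delta> $ i * \<beta> i
                      + (\<Sum>k\<in>I0. 1 / n k * L $ i $ k * (\<Sum>j\<in>-S. L $ j $ k * \<beta> j)) = 2 * r i) \<and>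
           (\<forall>i\<in>-S. \<Psi> i = 1 / 2 * \<beta> i) \<and>
           (\<forall>k\<in>I0. \<psi> k = 1 / (2 * n k) * (\<Sum>j\<in>-S. L $ j $ k * \<beta> j)) \<and>
           (\<forall>i\<in>-S. t $ i = - \<delta> $ i / 4 * (\<Psi> i)\<^sup>2
                            - 1 / 4 * (\<Sum>k | k \<in> I0 \<and> L $ i $ k \<noteq> 0. (\<psi> k)\<^sup>2)
                            - mu \<bullet> column i D + h $ i))"

end

theory Submission
  imports Defs
begin

text \<open>Each term of \<open>f_persp_ro\<close> is bounded below by an affine function: the perspective terms by
  \<open>p\<^sup>2 / s \<ge> a * p - a\<^sup>2 / 4 * s\<close>, valid for every slope \<open>a\<close>; the remaining quadratic terms by their
  tangents at the KKT point \<open>y\<close>; the two indicators by means of the multipliers. Where \<open>x $ i > 0\<close>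
  the slopes come from \<open>y\<close>; where a denominator vanishes they are \<open>\<Psi>\<close> and \<open>\<psi>\<close>, and the linear
  system for \<open>\<beta>\<close> says exactly that the coefficients of \<open>y'\<close> in the sum of these minorants vanish.
  What remains is affine in \<open>x'\<close> with gradient \<open>t\<close>, and the bound is tight at \<open>(x, y)\<close>.\<close>

section \<open>Affine minorants of the single terms\<close>

text \<open>For \<open>s > 0\<close>, expand \<open>(p - a * s / 2)\<^sup>2 \<ge> 0\<close> and
  divide by \<open>s\<close>; equality holds at \<open>a = 2 * p / s\<close>. At
  \<open>p = s = 0\<close> both sides vanish, and in all other cases the right side is
  infinite.\<close>

lemma persp_ge: "ereal (a * p - a\<^sup>2 / 4 * s) \<le> persp p s"
proof (cases "s > 0")
  case True
  have "0 \<le> (p - a * s / 2)\<^sup>2" by simp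
  then have "(a * p - a\<^sup>2 / 4 * s) * s \<le> p\<^sup>2"
    by (simp add: power2_eq_square field_simps)
  then show ?thesis using True by (simp add: persp_def pos_le_divide_eq)
next
  case False
  then show ?thesis by (auto simp: persp_def zero_ereal_def)
qed

text \<open>Weak Lagrangian duality for one block of constraints: on the feasible set the multiplier
  term is nonpositive, off it the indicator is infinite.\<close>

lemma ind_inner_ge:
  fixes l u v :: "real^'m"
  assumes "0 \<le> l" and "z \<in> S \<Longrightarrow> u \<le> v"
  shows "ereal (l \<bullet> (u - v)) \<le> ind S z"
proof (cases "z \<in> S")
  case True
  have "l \<bullet> (u - v) \<le> 0"
    unfolding inner_vec_def using assms True
    by (intro sum_nonpos) (auto simp: less_eq_vec_def mult_nonneg_nonpos)
  then show ?thesis using True by (simp add: ind_def zero_ereal_def)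
qed (simp add: ind_def)

section \<open>Matrix products and quadratic forms\<close>

lemma outer_mult_vec: "outer v *v y = (v \<bullet> y) *\<^sub>R v"
  by (simp add: vec_eq_iff matrix_vector_mult_def outer_def inner_vec_def sum_distrib_left
      sum_distrib_right mult_ac)

lemma sum_outer_mult_vec:
  fixes c :: "'k::finite \<Rightarrow> real^'n"
  shows "(\<Sum>k\<in>UNIV. outer (c k)) *v y = (\<Sum>k\<in>UNIV. (c k \<bullet> y) *\<^sub>R c k)"
proof -
  have "sum (\<lambda>k. outer (c k)) K *v y = (\<Sum>k\<in>K. (c k \<bullet> y) *\<^sub>R c k)" if "finite K" for K
    using that by induction (auto simp: matrix_vector_mult_add_rdistrib outer_mult_vec)
  then show ?thesis by simp
qed

lemma inner_diag_mat_mult_vec: "y \<bullet> (diag_mat d *v y) = (\<Sum>i\<in>UNIV. d $ i * (y $ i)\<^sup>2)"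
  by (simp add: inner_vec_def matrix_vector_mult_def diag_mat_def if_distrib[of "\<lambda>a. a * _"]
      power2_eq_square mult.left_commute cong: if_cong)

text \<open>The right side minus the left side is the form of \<open>N\<close> at
  \<open>z - y\<close>; symmetry of \<open>N\<close> merges the two cross terms.\<close>

lemma pos_semidef_tangent:
  assumes "pos_semidef N"
  shows "2 * ((N *v y) \<bullet> z) - y \<bullet> (N *v y) \<le> z \<bullet> (N *v z)"
proof -
  have "y \<bullet> (N *v z) = (N *v y) \<bullet> z"
    using assms by (metis dot_lmul_matrix pos_semidef_def transpose_matrix_vector)
  moreover have "0 \<le> (z - y) \<bullet> (N *v (z - y))"
    using assms by (simp add: pos_semidef_def)
  ultimately show ?thesis
    by (simp add: matrix_vector_mult_diff_distrib inner_diff_left inner_diff_right inner_commute)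
qed

lemma mult_cols_eq_mult_vec:
  assumes "\<forall>i\<in>-S. y $ i = 0"
  shows "mult_cols S M y = M *v y"
  unfolding mult_cols_def matrix_vector_mult_def vec_eq_iff
  using assms by (auto intro!: sum.mono_neutral_left)

lemma vector_matrix_mult_component: "(l v* M) $ i = column i M \<bullet> l"
  by (simp add: vector_matrix_mult_def column_def inner_vec_def mult.commute)

lemma column_component: "column k M $ i = M $ i $ k"
  by (simp add: column_def)

section \<open>Bounds on the extended-real function by real expressions\<close>

lemma f_persp_ro_ge:
  assumes "\<And>k. ereal (u k) \<le> max (ereal ((column k L \<bullet> y)\<^sup>2))
      (persp (column k L \<bullet> y) (\<Sum>j\<in>col_supp L k. x $ j))"
    and "q \<le> y \<bullet> (N *v y)"
    and "\<And>i. ereal (v i) \<le> persp (y $ i) (x $ i)"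
    and "\<And>i. 0 \<le> \<delta> $ i" and "0 \<le> lam" and "0 \<le> mu"
  shows "ereal ((\<Sum>k\<in>UNIV. u k) + q + (\<Sum>i\<in>UNIV. \<delta> $ i * v i) + g \<bullet> y + h \<bullet> x
           + lam \<bullet> (A *v y - b) + mu \<bullet> (C *v y - D *v x))
         \<le> f_persp_ro L N \<delta> g h A b C D x y"
proof -
  have v: "ereal (\<delta> $ i * v i) \<le> ereal (\<delta> $ i) * persp (y $ i) (x $ i)" for i
    using ereal_mult_left_mono[OF assms(3), of "ereal (\<delta> $ i)" i] assms(4) by simp
  show ?thesis
    \<comment> \<open>The real sum is rewritten as a sum of extended reals of the same shape as
      \<open>f_persp_ro\<close>, so that the comparison goes term by term.\<close>
    unfolding f_persp_ro_def plus_ereal.simps(1)[symmetric] sum_ereal[symmetric]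
    by (intro add_mono sum_mono ind_inner_ge) (use assms v in auto)
qed

text \<open>If some index of the support of a column is switched on, the denominator is at least 1
  and the plain square attains the maximum. Otherwise \<open>y\<close> vanishes on that support and
  the closed perspective is \<open>0 / 0 = 0\<close>. This serves both at the KKT point and at the
  points of \<open>feasible_Z\<close>.\<close>

lemma f_persp_ro_le_quadratic:
  fixes x y :: "real^'n"
  assumes "\<And>i. x $ i = 0 \<or> x $ i = 1" and "\<And>i. y $ i * (1 - x $ i) = 0"
    and "A *v y \<le> b" and "C *v y \<le> D *v x"
  shows "f_persp_ro L N \<delta> g h A b C D x y
    \<le> ereal ((\<Sum>k\<in>UNIV. (column k L \<bullet> y)\<^sup>2) + y \<bullet> (N *v y)
        + (\<Sum>i\<in>UNIV. \<delta> $ i * (y $ i)\<^sup>2) + g \<bullet> y + h \<bullet> x)"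
proof -
  have "max (ereal ((column k L \<bullet> y)\<^sup>2)) (persp (column k L \<bullet> y) (\<Sum>j\<in>col_supp L k. x $ j))
      \<le> ereal ((column k L \<bullet> y)\<^sup>2)" (is "max _ (persp ?p ?s) \<le> _") for k
  proof (cases "\<exists>j\<in>col_supp L k. x $ j = 1")
    case True
    then obtain j where "j \<in> col_supp L k" "x $ j = 1" by blast
    moreover have "0 \<le> x $ i" for i using assms(1)[of i] by auto
    ultimately have "1 \<le> ?s"
      using member_le_sum[of j "col_supp L k" "\<lambda>j. x $ j"] by simp
    then show ?thesis
      by (auto simp: persp_def divide_le_eq mult_le_cancel_left1)
  next
    case False
    then have x0: "x $ j = 0" if "j \<in> col_supp L k" for j using assms(1) that by blast
    have y0: "y $ j = 0" if "j \<in> col_supp L k" for j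
      using assms(2)[of j] x0[OF that] by simp
    have "?p = 0"
      unfolding inner_vec_def using y0 by (intro sum.neutral) (auto simp: column_def col_supp_def)
    then show ?thesis using x0 by (simp add: persp_def zero_ereal_def)
  qed
  moreover have "ereal (\<delta> $ i) * persp (y $ i) (x $ i) \<le> ereal (\<delta> $ i * (y $ i)\<^sup>2)" for i
    using assms(1)[of i] assms(2)[of i] by (auto simp: persp_def zero_ereal_def)
  moreover have "ind {y. A *v y \<le> b} y = ereal 0"
      "ind {(x, y). C *v y \<le> D *v x} (x, y) = ereal 0"
    using assms(3,4) by (simp_all add: ind_def zero_ereal_def)
  ultimately have "f_persp_ro L N \<delta> g h A b C D x y
     \<le> (\<Sum>k\<in>UNIV. ereal ((column k L \<bullet> y)\<^sup>2)) + ereal (y \<bullet> (N *v y))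
        + (\<Sum>i\<in>UNIV. ereal (\<delta> $ i * (y $ i)\<^sup>2)) + ereal (g \<bullet> y) + ereal (h \<bullet> x)
        + ereal 0 + ereal 0"
    unfolding f_persp_ro_def by (intro add_mono sum_mono) auto
  then show ?thesis by (simp add: sum_ereal)
qed

section \<open>The cut as a global minorant\<close>

text \<open>The \<open>y\<close> obtained is the primal KKT solution. As the bound holds for all
  \<open>y'\<close> and does not depend on it, it survives the infimum over
  \<open>y'\<close>.\<close>

lemma cut_minorizes_f:
  fixes L :: "real^'k^'n" and N :: "real^'n^'n"
    and A :: "real^'n^'p" and C D :: "real^'n^'q"
  assumes N: "pos_semidef N" and \<delta>: "\<And>i. 0 \<le> \<delta> $ i"
    and R: "R = (\<Sum>k\<in>UNIV. outer (column k L)) + N"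
    and bin: "\<And>i. x $ i = 0 \<or> x $ i = 1"
    and cut: "cut_persp_ro L R \<delta> g h A b C D x t"
  obtains y where "\<And>i. y $ i * (1 - x $ i) = 0" "A *v y \<le> b" "C *v y \<le> D *v x"
    "\<And>x' y'. ereal ((\<Sum>k\<in>UNIV. (column k L \<bullet> y)\<^sup>2) + y \<bullet> (N *v y)
        + (\<Sum>i\<in>UNIV. \<delta> $ i * (y $ i)\<^sup>2) + g \<bullet> y + h \<bullet> x + t \<bullet> (x' - x))
      \<le> f_persp_ro L N \<delta> g h A b C D x' y'"
proof -
  define S where "S = {i. x $ i > 0}"
  define I0 where "I0 = {k. column k L \<noteq> 0 \<and> (\<Sum>l\<in>col_supp L k. x $ l) = 0}"
  define n where "n = (\<lambda>k. real (card (col_supp L k)))"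
  obtain y lam mu r \<beta> \<Psi> \<psi> where
    kkt: "is_kkt R \<delta> g A b C D S x y lam mu"
    and tS: "\<forall>i\<in>S. t $ i = - \<delta> $ i * (y $ i)\<^sup>2 / (x $ i)\<^sup>2 - mu \<bullet> column i D + h $ i"
    and r: "\<forall>i\<in>-S. r i = - 2 * (\<Sum>j\<in>S. R $ i $ j * y $ j) - g $ i
                     - lam \<bullet> column i A - mu \<bullet> column i C"
    and \<beta>: "\<forall>i\<in>-S. \<delta> $ i * \<beta> i
              + (\<Sum>k\<in>I0. 1 / n k * L $ i $ k * (\<Sum>j\<in>-S. L $ j $ k * \<beta> j)) = 2 * r i"
    and \<Psi>: "\<forall>i\<in>-S. \<Psi> i = 1 / 2 * \<beta> i"
    and \<psi>: "\<forall>k\<in>I0. \<psi> k = 1 / (2 * n k) * (\<Sum>j\<in>-S. L $ j $ k * \<beta> j)"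
    and tC: "\<forall>i\<in>-S. t $ i = - \<delta> $ i / 4 * (\<Psi> i)\<^sup>2
               - 1 / 4 * (\<Sum>k | k \<in> I0 \<and> L $ i $ k \<noteq> 0. (\<psi> k)\<^sup>2)
               - mu \<bullet> column i D + h $ i"
    using cut unfolding cut_persp_ro_def Let_def S_def[symmetric] I0_def[symmetric] n_def[symmetric]
    by blast
  have xS: "x $ i = 1" if "i \<in> S" for i using that bin[of i] by (auto simp: S_def)
  have xC: "x $ i = 0" if "i \<notin> S" for i using that bin[of i] by (auto simp: S_def)
  have yC: "\<forall>i\<in>-S. y $ i = 0" using kkt by (simp add: is_kkt_def)
  note mc = mult_cols_eq_mult_vec[OF yC]
  have feas: "A *v y \<le> b" "C *v y \<le> D *v x" and nonneg: "0 \<le> lam" "0 \<le> mu"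
    and compl: "lam \<bullet> (A *v y - b) = 0" "mu \<bullet> (C *v y - D *v x) = 0"
    and stat: "\<forall>i\<in>S. 2 * ((R *v y) $ i + \<delta> $ i / x $ i * y $ i) + g $ i
                + column i A \<bullet> lam + column i C \<bullet> mu = 0"
    using kkt by (simp_all add: is_kkt_def mc)
  have sum_R: "(\<Sum>j\<in>S. R $ i $ j * y $ j) = (R *v y) $ i" for i
    using mc[of R] by (simp add: mult_cols_def vec_eq_iff)
  have Ry: "(R *v y) $ i = (\<Sum>k\<in>UNIV. (column k L \<bullet> y) * L $ i $ k) + (N *v y) $ i" for i
    by (simp add: R matrix_vector_mult_add_rdistrib sum_outer_mult_vec column_def)

  \<comment> \<open>A zero sum of nonnegative \<open>x $ l\<close> is zero termwise, so a column in
    \<open>I0\<close> is supported off \<open>S\<close>, whereas \<open>y\<close> is supported on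
    \<open>S\<close>. This also gives \<open>Ly_I0\<close>.\<close>
  have supp_I0: "L $ i $ k = 0" if "k \<in> I0" "i \<in> S" for i k
  proof (rule ccontr)
    assume "L $ i $ k \<noteq> 0"
    then have "i \<in> col_supp L k" by (simp add: col_supp_def)
    moreover have "0 \<le> x $ l" for l using bin[of l] by auto
    then have "\<forall>l\<in>col_supp L k. x $ l = 0"
      using that(1) sum_nonneg_eq_0_iff[of "col_supp L k" "\<lambda>l. x $ l"] by (simp add: I0_def)
    ultimately show False using xS[OF that(2)] by simp
  qed
  have Ly_I0: "column k L \<bullet> y = 0" if "k \<in> I0" for k
    unfolding inner_vec_def
  proof (rule sum.neutral, rule ballI)
    fix i show "column k L $ i \<bullet> y $ i = 0"
      using supp_I0[OF that, of i] yC by (cases "i \<in> S") (auto simp: column_def)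
  qed

  \<comment> \<open>Slopes of the minorants. For \<open>k\<close> in \<open>I0\<close> the
    perspective branch of the maximum is used; for other \<open>k\<close> the plain square is
    replaced by its tangent at \<open>y\<close>, which is free of \<open>x'\<close>, so
    \<open>\<rho> k = 0\<close>. In \<open>w\<close>, the slope \<open>2 * y $ i\<close> is the
    tight one, since \<open>x $ i = 1\<close> on \<open>S\<close>.\<close>
  define \<alpha> where "\<alpha> k = (if k \<in> I0 then \<psi> k else 2 * (column k L \<bullet> y))" for k
  define \<rho> where "\<rho> k = (if k \<in> I0 then (\<psi> k)\<^sup>2 else 0)" for k
  define w where "w i = (if i \<in> S then 2 * y $ i else \<Psi> i)" for i
  define u where "u x' y' k = \<alpha> k * (column k L \<bullet> y') - \<rho> k / 4 * (\<Sum>j\<in>col_supp L k. x' $ j)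
      - (column k L \<bullet> y)\<^sup>2" for x' y' :: "real^'n" and k
  define v where "v x' y' i = w i * y' $ i - (w i)\<^sup>2 / 4 * x' $ i" for x' y' :: "real^'n" and i
  define m where "m x' y' = (\<Sum>k\<in>UNIV. u x' y' k) + (2 * ((N *v y) \<bullet> y') - y \<bullet> (N *v y))
      + (\<Sum>i\<in>UNIV. \<delta> $ i * v x' y' i) + g \<bullet> y' + h \<bullet> x'
      + lam \<bullet> (A *v y' - b) + mu \<bullet> (C *v y' - D *v x')" for x' y' :: "real^'n"

  have "ereal (m x' y') \<le> f_persp_ro L N \<delta> g h A b C D x' y'" for x' y'
    unfolding m_def
  proof (rule f_persp_ro_ge)
    fix k
    show "ereal (u x' y' k) \<le> max (ereal ((column k L \<bullet> y')\<^sup>2))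
        (persp (column k L \<bullet> y') (\<Sum>j\<in>col_supp L k. x' $ j))"
    proof (cases "k \<in> I0")
      case True
      then show ?thesis
        using persp_ge[of "\<psi> k" "column k L \<bullet> y'" "\<Sum>j\<in>col_supp L k. x' $ j"] Ly_I0[OF True]
        by (simp add: u_def \<alpha>_def \<rho>_def le_max_iff_disj)
    next
      case False
      have "0 \<le> (column k L \<bullet> y' - column k L \<bullet> y)\<^sup>2" by simp
      then have "u x' y' k \<le> (column k L \<bullet> y')\<^sup>2"
        using False by (simp add: u_def \<alpha>_def \<rho>_def power2_eq_square algebra_simps)
      then show ?thesis by (simp add: le_max_iff_disj)
    qed
  next
    show "ereal (v x' y' i) \<le> persp (y' $ i) (x' $ i)" for i
      unfolding v_def by (rule persp_ge)
  qed (use N \<delta> nonneg pos_semidef_tangent in auto)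

  moreover have "m x' y' = (\<Sum>k\<in>UNIV. (column k L \<bullet> y)\<^sup>2) + y \<bullet> (N *v y)
        + (\<Sum>i\<in>UNIV. \<delta> $ i * (y $ i)\<^sup>2) + g \<bullet> y + h \<bullet> x + t \<bullet> (x' - x)" for x' y'
  proof -
    \<comment> \<open>\<open>G\<close> and \<open>T\<close> are the coefficients of
      \<open>y'\<close> and \<open>x'\<close> in \<open>m\<close>; \<open>P k\<close> is the
      indicator vector of the support of column \<open>k\<close>, which turns the denominators into
      inner products.\<close>
    define G where "G = (\<Sum>k\<in>UNIV. \<alpha> k *\<^sub>R column k L) + 2 *\<^sub>R (N *v y) + (\<chi> i. \<delta> $ i * w i)
        + g + lam v* A + mu v* C"
    define P where "P k = (\<chi> i. if L $ i $ k \<noteq> 0 then 1 else (0::real))" for k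
    define T where "T = h - (\<chi> i. \<delta> $ i * (w i)\<^sup>2 / 4) - (\<Sum>k\<in>UNIV. (\<rho> k / 4) *\<^sub>R P k) - mu v* D"
    have P: "P k \<bullet> z = (\<Sum>j\<in>col_supp L k. z $ j)" for k z
      by (simp add: P_def inner_vec_def col_supp_def if_distrib[of "\<lambda>a. a * _"] sum.If_cases
          cong: if_cong)
    have affine: "m x' y' = G \<bullet> y' + T \<bullet> x' - (\<Sum>k\<in>UNIV. (column k L \<bullet> y)\<^sup>2)
        - y \<bullet> (N *v y) - lam \<bullet> b" for x' y'
    proof -
      have "(\<Sum>k\<in>UNIV. u x' y' k) = (\<Sum>k\<in>UNIV. \<alpha> k *\<^sub>R column k L) \<bullet> y'
          - (\<Sum>k\<in>UNIV. (\<rho> k / 4) *\<^sub>R P k) \<bullet> x' - (\<Sum>k\<in>UNIV. (column k L \<bullet> y)\<^sup>2)"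
        by (simp add: u_def sum_subtractf inner_sum_left P)
      moreover have "(\<Sum>i\<in>UNIV. \<delta> $ i * v x' y' i)
          = (\<chi> i. \<delta> $ i * w i) \<bullet> y' - (\<chi> i. \<delta> $ i * (w i)\<^sup>2 / 4) \<bullet> x'"
        by (simp add: v_def inner_vec_def sum_subtractf right_diff_distrib mult.assoc)
      ultimately show ?thesis
        by (simp add: m_def G_def T_def dot_lmul_matrix inner_add_left inner_diff_left inner_diff_right)
    qed
    \<comment> \<open>On \<open>S\<close> this is KKT stationarity; off \<open>S\<close> it is half
      of the linear system for \<open>\<beta>\<close>.\<close>
    have "G $ i = 0" for i
    proof (cases "i \<in> S")
      case True
      have "\<alpha> k * L $ i $ k = 2 * ((column k L \<bullet> y) * L $ i $ k)" for k
        using supp_I0[OF _ True] by (simp add: \<alpha>_def)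
      then have "(\<Sum>k\<in>UNIV. \<alpha> k * L $ i $ k) = 2 * (\<Sum>k\<in>UNIV. (column k L \<bullet> y) * L $ i $ k)"
        unfolding sum_distrib_left by (rule sum.cong[OF refl])
      then show ?thesis
        using True stat[rule_format, OF True] xS[OF True]
        by (simp add: G_def w_def Ry vector_matrix_mult_component column_component)
    next
      case False
      have "\<alpha> k * L $ i $ k = 2 * ((column k L \<bullet> y) * L $ i $ k)
          + (if k \<in> I0 then \<psi> k * L $ i $ k else 0)" for k
        by (simp add: \<alpha>_def Ly_I0)
      then have sum_\<alpha>: "(\<Sum>k\<in>UNIV. \<alpha> k * L $ i $ k)
          = 2 * (\<Sum>k\<in>UNIV. (column k L \<bullet> y) * L $ i $ k) + (\<Sum>k\<in>I0. \<psi> k * L $ i $ k)"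
        by (simp add: sum.distrib sum_distrib_left sum.If_cases)
      \<comment> \<open>The factor \<open>1 / (2 * n k)\<close> in \<open>\<psi>\<close> absorbs the
        weight \<open>1 / n k\<close> and the halving of the system.\<close>
      have "2 * (\<Sum>k\<in>I0. \<psi> k * L $ i $ k)
          = (\<Sum>k\<in>I0. 1 / n k * L $ i $ k * (\<Sum>j\<in>-S. L $ j $ k * \<beta> j))"
        using \<psi> by (simp add: sum_distrib_left[of 2] mult.commute)
      moreover have "\<delta> $ i * \<beta> i = 2 * (\<delta> $ i * \<Psi> i)"
        using False \<Psi>[rule_format, of i] by simp
      moreover have "i \<in> -S" using False by simp
      ultimately have "\<delta> $ i * \<Psi> i + (\<Sum>k\<in>I0. \<psi> k * L $ i $ k) = r i"
        using \<beta>[rule_format, of i] by linarith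
      then show ?thesis
        using False sum_\<alpha> r[rule_format, of i]
        by (simp add: G_def w_def sum_R Ry vector_matrix_mult_component column_component inner_commute)
    qed
    then have G: "G = 0" by (simp add: vec_eq_iff)
    have T_component: "T $ i = h $ i - \<delta> $ i * (w i)\<^sup>2 / 4
        - (\<Sum>k\<in>UNIV. \<rho> k * P k $ i) / 4 - mu \<bullet> column i D" for i
      by (simp add: T_def vector_matrix_mult_component inner_commute sum_divide_distrib)
    have "T $ i = t $ i" for i
    proof (cases "i \<in> S")
      case True
      have "(\<Sum>k\<in>UNIV. \<rho> k * P k $ i) = 0"
        using supp_I0[OF _ True] by (intro sum.neutral) (simp add: \<rho>_def P_def)
      then show ?thesis
        using True tS xS[OF True]
        by (simp add: T_component w_def power_mult_distrib)
    next
      case False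
      have "(\<Sum>k\<in>UNIV. \<rho> k * P k $ i) = (\<Sum>k | k \<in> I0 \<and> L $ i $ k \<noteq> 0. (\<psi> k)\<^sup>2)"
        by (rule sum.mono_neutral_cong_right) (auto simp: \<rho>_def P_def)
      then show ?thesis
        using False tC
        by (simp add: T_component w_def)
    qed
    then have T: "T = t" by (simp add: vec_eq_iff)
    \<comment> \<open>Tightness at \<open>(x, y)\<close>: for \<open>k\<close> in \<open>I0\<close>
      both sides are zero, and a tangent agrees with its square at the point of contact. The
      multiplier terms vanish by complementary slackness.\<close>
    have "u x y k = (column k L \<bullet> y)\<^sup>2" for k
      by (cases "k \<in> I0") (auto simp: u_def \<alpha>_def \<rho>_def Ly_I0 I0_def power2_eq_square)
    moreover have "v x y i = (y $ i)\<^sup>2" for i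
      by (cases "i \<in> S") (use yC in \<open>auto simp: v_def w_def xS xC power2_eq_square\<close>)
    ultimately have "m x y = (\<Sum>k\<in>UNIV. (column k L \<bullet> y)\<^sup>2) + y \<bullet> (N *v y)
        + (\<Sum>i\<in>UNIV. \<delta> $ i * (y $ i)\<^sup>2) + g \<bullet> y + h \<bullet> x"
      by (simp add: m_def compl inner_commute)
    \<comment> \<open>An affine function with gradient \<open>(0, t)\<close> is determined by its
      value at \<open>(x, y)\<close>.\<close>
    moreover have "m x' y' = m x y + t \<bullet> (x' - x)"
      by (simp add: affine G T inner_diff_right)
    ultimately show ?thesis by simp
  qed
  moreover have "y $ i * (1 - x $ i) = 0" for i
    using yC xS by (cases "i \<in> S") auto
  ultimately show thesis using that[of y] feas by auto
qed

section \<open>From the minorant to the subgradient and the cut\<close>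

theorem proposition3:
  fixes X :: "(real^'n) set"
    and Q N R :: "real^'n^'n"
    and L :: "real^'k^'n"
    and g h \<delta> x t :: "real^'n"
    and A :: "real^'n^'p" and b :: "real^'p"
    and C D :: "real^'n^'q"
  assumes "pos_def Q"
    and "X \<subseteq> {x. \<forall>i. x $ i \<in> {0, 1}}"
    and "feasible_Z X Q g h A b C D \<noteq> {}"
    and "CARD('k) \<le> CARD('n)"
    and "pos_semidef N"
    and "\<forall>i. \<delta> $ i > 0"
    and "Q = (\<Sum>k\<in>UNIV. outer (column k L)) + diag_mat \<delta> + N"
    and "R = (\<Sum>k\<in>UNIV. outer (column k L)) + N"
    and "x \<in> X"
    and "cut_persp_ro L R \<delta> g h A b C D x t"
  shows "t \<in> subdifferential (fbar_persp_ro L N \<delta> g h A b C D) x \<and>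
         (\<forall>(x', y', \<eta>') \<in> feasible_Z X Q g h A b C D.
            ereal \<eta>' \<ge> ereal (t \<bullet> (x' - x)) + fbar_persp_ro L N \<delta> g h A b C D x)"
proof -
  let ?f = "f_persp_ro L N \<delta> g h A b C D" and ?F = "fbar_persp_ro L N \<delta> g h A b C D"
  let ?q = "\<lambda>x y. (\<Sum>k\<in>UNIV. (column k L \<bullet> y)\<^sup>2) + y \<bullet> (N *v y)
      + (\<Sum>i\<in>UNIV. \<delta> $ i * (y $ i)\<^sup>2) + g \<bullet> y + h \<bullet> x"
  have bin: "z $ i = 0 \<or> z $ i = 1" if "z \<in> X" for z i
    using assms(2) that by auto
  obtain y where y: "\<And>i. y $ i * (1 - x $ i) = 0" "A *v y \<le> b" "C *v y \<le> D *v x"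
    and ge: "\<And>x' y'. ereal (?q x y + t \<bullet> (x' - x)) \<le> ?f x' y'"
    using cut_minorizes_f[OF assms(5) _ assms(8) bin[OF assms(9)] assms(10)] assms(6)
    by (auto simp: less_imp_le)
  have F_ge: "ereal (?q x y + t \<bullet> (z - x)) \<le> ?F z" for z
    unfolding fbar_persp_ro_def by (rule INF_greatest) (rule ge)
  \<comment> \<open>The upper bound at \<open>y\<close> meets \<open>F_ge\<close> at
    \<open>z = x\<close>. So \<open>?F x\<close> is finite, as membership in the subdifferential
    demands.\<close>
  have "?F x \<le> ?f x y"
    unfolding fbar_persp_ro_def by (rule INF_lower) simp
  also have "\<dots> \<le> ereal (?q x y)"
    by (rule f_persp_ro_le_quadratic[OF bin[OF assms(9)] y])
  finally have Fx: "?F x = ereal (?q x y)"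
    using F_ge[of x] by (simp add: antisym)
  have "t \<in> subdifferential ?F x"
    using F_ge by (simp add: subdifferential_def Fx)
  moreover have "ereal (t \<bullet> (x' - x)) + ?F x \<le> ereal \<eta>'"
    if "(x', y', \<eta>') \<in> feasible_Z X Q g h A b C D" for x' y' \<eta>'
  proof -
    have Z: "x' \<in> X" "y' \<bullet> (Q *v y') + g \<bullet> y' + h \<bullet> x' \<le> \<eta>'" "A *v y' \<le> b" "C *v y' \<le> D *v x'"
        "\<And>i. y' $ i * (1 - x' $ i) = 0"
      using that by (auto simp: feasible_Z_def)
    \<comment> \<open>The decomposition of \<open>Q\<close> turns the objective of
      \<open>feasible_Z\<close> into \<open>?q x' y'\<close>, which dominates
      \<open>?f x' y'\<close> at binary \<open>x'\<close>.\<close>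
    have "y' \<bullet> (Q *v y') = (\<Sum>k\<in>UNIV. (column k L \<bullet> y')\<^sup>2) + y' \<bullet> (N *v y')
        + (\<Sum>i\<in>UNIV. \<delta> $ i * (y' $ i)\<^sup>2)"
      by (simp add: assms(7) matrix_vector_mult_add_rdistrib inner_add_right sum_outer_mult_vec
          inner_sum_right inner_diag_mat_mult_vec power2_eq_square inner_commute)
    then have "?q x' y' \<le> \<eta>'" using Z(2) by simp
    have "ereal (t \<bullet> (x' - x)) + ?F x = ereal (?q x y + t \<bullet> (x' - x))"
      by (simp add: Fx add.commute)
    also have "\<dots> \<le> ?f x' y'" by (rule ge)
    also have "\<dots> \<le> ereal (?q x' y')"
      by (rule f_persp_ro_le_quadratic[OF bin[OF Z(1)] Z(5,3,4)])
    also have "\<dots> \<le> ereal \<eta>'" using \<open>?q x' y' \<le> \<eta>'\<close> by simp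
    finally show ?thesis .
  qed
  ultimately show ?thesis by auto
qed

end
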